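(* Let $\mathcal{P}$ be a non-trivial Poisson algebra of dimension $n$ over an algebraically closed field. If $\mathcal{P}$ has a maximal subalgebra $B$ which is abelian, then $\mathcal{P}^{1)}\subseteq B$, $\mathcal{P}$ is solvable and $\mathcal{P}^{2)}=0$.
   Context: A Poisson algebra over a field $\mathbb{F}$ is an $\mathbb{F}$-vector space $\mathcal{P}$ with two bilinear multiplications, $\cdot$ (written by concatenation) and $[\cdot,\cdot]$, such that $(\mathcal{P},\cdot)$ is an associative commutative algebra (not necessarily unital), $(\mathcal{P},[\cdot,\cdot])$ is a Lie algebra, and $[xy,z]=[x,z]y+x[y,z]$ for all $x,y,z$. $\mathcal{P}$ is trivial if at least one of the two multiplications is zero; non-trivial means both multiplications are non-zero. A subalgebra is a linear subspace closed under both multiplications; a maximal subalgebra is a proper subalgebra not strictly contained in any other proper subalgebra; a subalgebra $B$ is abelian if $B\cdot B+[B,B]=0$. The derived sequence is $\mathcal{P}^{0)}=\mathcal{P}$, $\mathcal{P}^{k+1)}=\mathcal{P}^{k)}\cdot\mathcal{P}^{k)}+[\mathcal{P}^{k)},\mathcal{P}^{k)}]$; $\mathcal{P}$ is solvable if $\mathcal{P}^{m)}=0$ for some $m\ge0$. *)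

theory Defs
  imports "HOL-Computational_Algebra.Polynomial"
begin

text \<open>
  The associative multiplication is not required to have a unit. The Lie bracket is
  alternating, which is stronger than antisymmetric in characteristic 2.
\<close>
locale poisson_algebra = vector_space scale
  for scale :: "'f::field \<Rightarrow> 'v::ab_group_add \<Rightarrow> 'v" (infixr \<open>*s\<close> 75) +
  fixes mult :: "'v \<Rightarrow> 'v \<Rightarrow> 'v" (infixl \<open>\<cdot>\<close> 70)
    and brk :: "'v \<Rightarrow> 'v \<Rightarrow> 'v"
  assumes mult_linear_left: "Vector_Spaces.linear scale scale (\<lambda>x. x \<cdot> y)"
    and mult_linear_right: "Vector_Spaces.linear scale scale (\<lambda>y. x \<cdot> y)"
    and brk_linear_left: "Vector_Spaces.linear scale scale (\<lambda>x. brk x y)"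
    and brk_linear_right: "Vector_Spaces.linear scale scale (\<lambda>y. brk x y)"
    and mult_assoc: "(x \<cdot> y) \<cdot> z = x \<cdot> (y \<cdot> z)"
    and mult_commute: "x \<cdot> y = y \<cdot> x"
    and brk_alternating: "brk x x = 0"
    and brk_jacobi: "brk x (brk y z) + brk y (brk z x) + brk z (brk x y) = 0"
    and brk_leibniz: "brk (x \<cdot> y) z = brk x z \<cdot> y + x \<cdot> brk y z"
begin

definition trivial :: bool where
  "trivial \<longleftrightarrow> (\<forall>x y. x \<cdot> y = 0) \<or> (\<forall>x y. brk x y = 0)"

definition subalgebra :: "'v set \<Rightarrow> bool" where
  "subalgebra B \<longleftrightarrow> subspace B \<and> (\<forall>x\<in>B. \<forall>y\<in>B. x \<cdot> y \<in> B \<and> brk x y \<in> B)"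

definition maximal_subalgebra :: "'v set \<Rightarrow> bool" where
  "maximal_subalgebra B \<longleftrightarrow> subalgebra B \<and> B \<noteq> UNIV \<and>
     (\<forall>C. subalgebra C \<longrightarrow> C \<noteq> UNIV \<longrightarrow> \<not> B \<subset> C)"

text \<open>
  \<open>mult_space A C\<close> and \<open>brk_space A C\<close> are the subspaces \<open>A \<cdot> C\<close> and \<open>[A, C]\<close>, the
  linear spans of the sets of products; \<open>square_space A\<close> is \<open>A \<cdot> A + [A, A]\<close>.
\<close>
definition mult_space :: "'v set \<Rightarrow> 'v set \<Rightarrow> 'v set" where
  "mult_space A C = span {x \<cdot> y | x y. x \<in> A \<and> y \<in> C}"

definition brk_space :: "'v set \<Rightarrow> 'v set \<Rightarrow> 'v set" where
  "brk_space A C = span {brk x y | x y. x \<in> A \<and> y \<in> C}"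

definition square_space :: "'v set \<Rightarrow> 'v set" where
  "square_space A = {u + v | u v. u \<in> mult_space A A \<and> v \<in> brk_space A A}"

definition abelian_subalgebra :: "'v set \<Rightarrow> bool" where
  "abelian_subalgebra B \<longleftrightarrow> subalgebra B \<and> square_space B = {0}"

primrec derived :: "nat \<Rightarrow> 'v set" where
  "derived 0 = UNIV"
| "derived (Suc k) = square_space (derived k)"

definition solvable :: bool where
  "solvable \<longleftrightarrow> (\<exists>m. derived m = {0})"

end

end

theory Submission
  imports Defs
begin

text \<open>
  Since \<open>B\<close> is abelian, \<open>B \<cdot> P \<subseteq> B\<close>, and the commuting operators \<open>[b, -]\<close> with \<open>b \<in> B\<close> have a
  common eigenvector \<open>x\<close> modulo \<open>B\<close>. Then \<open>x \<cdot> P + B\<close> is a subalgebra. If it is all of \<open>P\<close>,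
  there is an idempotent \<open>u\<close> modulo \<open>B\<close>; derivations kill idempotents, so \<open>[B, u] = 0\<close> and
  the bracket vanishes on \<open>P = B + F u\<close>. Otherwise \<open>x \<cdot> P \<subseteq> B\<close> and \<open>P = B + F x\<close>; a nonzero eigenvalue
  \<open>[b, x] = c x + d\<close> would give \<open>x \<cdot> B = 0\<close> by applying \<open>[b, -]\<close> to \<open>x \<cdot> a \<in> B\<close>, and then
  \<open>0 = [b \<cdot> x, x] = c (x \<cdot> x)\<close>, so that the multiplication would vanish. Hence \<open>[B, x] \<subseteq> B\<close>.
\<close>

section \<open>Eigenvectors modulo a subspace\<close>

text \<open>This is \<open>p(T) x\<close>, evaluated by Horner's scheme on the vector, so that no
  algebra of operators has to be set up.\<close>

definition poly_apply ::
    "('a::zero \<Rightarrow> 'b::ab_group_add \<Rightarrow> 'b) \<Rightarrow> ('b \<Rightarrow> 'b) \<Rightarrow> 'a poly \<Rightarrow> 'b \<Rightarrow> 'b" where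
  "poly_apply scale T p x = fold_coeffs (\<lambda>a y. scale a x + T y) p 0"

lemma poly_apply_0 [simp]: "poly_apply scale T 0 x = 0"
  by (simp add: poly_apply_def)

context vector_space
begin

lemma poly_apply_pCons:
  assumes "Vector_Spaces.linear scale scale T"
  shows "poly_apply scale T (pCons a p) x = scale a x + T (poly_apply scale T p x)"
proof -
  \<comment> \<open>\<open>fold_coeffs\<close> drops leading zeros, so the degenerate case
    \<open>pCons 0 0 = 0\<close> needs this separately.\<close>
  have "T 0 = 0"
    using assms by (simp add: linear_iff_module_hom module_hom.zero)
  then show ?thesis
    by (cases "pCons a p = 0") (auto simp: poly_apply_def fold_coeffs_def cCons_def)
qed

lemma poly_apply_add:
  assumes "Vector_Spaces.linear scale scale T"
  shows "poly_apply scale T (p + q) x = poly_apply scale T p x + poly_apply scale T q x"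
  using assms by (induction p q rule: poly_induct2)
    (simp_all add: poly_apply_pCons linear_iff_module_hom module_hom.add scale_left_distrib)

lemma poly_apply_smult:
  assumes "Vector_Spaces.linear scale scale T"
  shows "poly_apply scale T (smult c p) x = scale c (poly_apply scale T p x)"
  using assms by (induction p)
    (simp_all add: poly_apply_pCons linear_iff_module_hom module_hom.scale scale_right_distrib)

lemma poly_apply_sum:
  assumes "Vector_Spaces.linear scale scale T"
  shows "poly_apply scale T (sum f A) x = (\<Sum>i\<in>A. poly_apply scale T (f i) x)"
  by (induction A rule: infinite_finite_induct) (simp_all add: poly_apply_add[OF assms])

lemma poly_apply_linear_factor:
  assumes "Vector_Spaces.linear scale scale T"
  shows "poly_apply scale T ([:- c, 1:] * p) x = T (poly_apply scale T p x) - scale c (poly_apply scale T p x)"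
proof -
  have "[:- c, 1:] * p = pCons 0 p + smult (- c) p"
    by simp
  then show ?thesis
    by (simp only: poly_apply_add[OF assms] poly_apply_smult[OF assms] poly_apply_pCons[OF assms])
      simp
qed

lemma poly_apply_mem:
  assumes "Vector_Spaces.linear scale scale T" "subspace W" "T ` W \<subseteq> W" "x \<in> W"
  shows "poly_apply scale T p x \<in> W"
  using assms by (induction p) (auto simp: poly_apply_pCons subspace_0 subspace_add subspace_scale)

text \<open>Preimages of \<open>V\<close> under linear maps are subspaces, so span induction works
  in one argument at a time. Closure can thus be tested on generators.\<close>

lemma span_bilinear_mem:
  assumes "\<And>y. Vector_Spaces.linear scale scale (\<lambda>x. m x y)"
    and "\<And>x. Vector_Spaces.linear scale scale (m x)"
    and "subspace V"
    and "\<And>x y. x \<in> S \<Longrightarrow> y \<in> S \<Longrightarrow> m x y \<in> V"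
    and "x \<in> span S" "y \<in> span S"
  shows "m x y \<in> V"
proof -
  have sub: "subspace {x. h x \<in> V}" if "Vector_Spaces.linear scale scale h" for h
    using that assms(3) module_hom.subspace_vimage[of scale scale h V]
    by (simp add: linear_iff_module_hom vimage_def)
  have "m s y \<in> V" if "s \<in> S" for s
    using span_induct[OF assms(6) sub[OF assms(2), of s]] assms(4)[OF that] by blast
  then show ?thesis
    using span_induct[OF assms(5) sub[OF assms(1), of y]] by blast
qed

end

text \<open>Otherwise the iterates of \<open>T\<close> on \<open>x\<close> would be distinct and
  independent, giving an infinite independent set.\<close>

lemma (in finite_dimensional_vector_space) annihilating_poly_exists:
  assumes T: "Vector_Spaces.linear scale scale T"
  shows "\<exists>p. p \<noteq> 0 \<and> poly_apply scale T p x = 0"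
proof (rule ccontr)
  assume "\<not> ?thesis"
  then have inj: "p = 0" if "poly_apply scale T p x = 0" for p
    using that by blast
  define f where "f n = poly_apply scale T (monom 1 n) x" for n
  have "inj f"
  proof
    fix m n
    assume "f m = f n"
    then have "poly_apply scale T (monom 1 m + smult (- 1) (monom 1 n)) x = 0"
      by (simp only: poly_apply_add[OF T] poly_apply_smult[OF T] f_def) simp
    then have "monom 1 m = (monom 1 n :: 'a poly)"
      using inj by fastforce
    then show "m = n"
      by (metis degree_monom_eq zero_neq_one)
  qed
  have "independent (range f)"
    unfolding independent_explicit_module
  proof (intro allI impI)
    fix t u v
    assume t: "finite t" "t \<subseteq> range f" "(\<Sum>v\<in>t. scale (u v) v) = 0" "v \<in> t"
    obtain N where N: "finite N" "t = f ` N"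
      by (metis finite_subset_image t(1,2))
    \<comment> \<open>A linear relation among the iterates is read as a polynomial that annihilates
      \<open>x\<close>.\<close>
    define p where "p = (\<Sum>n\<in>N. monom (u (f n)) n)"
    have mon: "poly_apply scale T (monom c n) x = scale c (f n)" for c n
      using poly_apply_smult[OF T, of c "monom 1 n"] by (simp add: f_def smult_monom)
    have "poly_apply scale T p x = (\<Sum>n\<in>N. scale (u (f n)) (f n))"
      by (simp add: p_def poly_apply_sum[OF T] mon)
    also have "\<dots> = (\<Sum>v\<in>t. scale (u v) v)"
      using \<open>inj f\<close> by (simp add: N sum.reindex inj_on_subset)
    finally have "p = 0"
      using inj t by simp
    obtain n where n: "n \<in> N" "v = f n"
      using N t by blast
    have "coeff p n = u (f n)"
      using N n by (simp add: p_def coeff_sum)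
    then show "u v = 0"
      using \<open>p = 0\<close> n by simp
  qed
  then show False
    using finiteI_independent \<open>inj f\<close> finite_imageD infinite_UNIV_nat by blast
qed

text \<open>Linear factors are split off \<open>p\<close> one by one. If
  \<open>p = [:- c, 1:] * q\<close>, either \<open>q\<close> sends \<open>x\<close> into
  \<open>B\<close> and replaces \<open>p\<close>, or \<open>q(T) x\<close> is the eigenvector with
  eigenvalue \<open>c\<close>. A nonzero constant cannot send \<open>x\<close> into
  \<open>B\<close>.\<close>

lemma eigenvector_mod_of_annihilating_poly:
  fixes scale :: "'f::alg_closed_field \<Rightarrow> 'v::ab_group_add \<Rightarrow> 'v"
  assumes "vector_space scale" and T: "Vector_Spaces.linear scale scale T"
    and B: "module.subspace scale B"
    and W: "module.subspace scale W" "T ` W \<subseteq> W"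
    and x: "x \<in> W" "x \<notin> B"
    and p: "p \<noteq> 0" "poly_apply scale T p x \<in> B"
  shows "\<exists>c. \<exists>y\<in>W - B. T y - scale c y \<in> B"
proof -
  interpret vector_space scale by fact
  show ?thesis
    using p
  proof (induction "degree p" arbitrary: p)
    case 0
    then obtain a where "p = [:a:]" "a \<noteq> 0"
      by (metis degree_eq_zeroE pCons_eq_0_iff)
    moreover have "T 0 = 0"
      using T by (simp add: linear_iff_module_hom module_hom.zero)
    ultimately have "scale a x \<in> B"
      using 0 by (simp add: poly_apply_pCons[OF T] poly_apply_0)
    then have "scale (inverse a) (scale a x) \<in> B"
      using B subspace_scale by blast
    then show ?case
      using x \<open>a \<noteq> 0\<close> by simp
  next
    case (Suc d)
    then obtain c where "poly p c = 0"
      using alg_closed_imp_poly_has_root by (metis zero_less_Suc)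
    then obtain q where q: "p = [:- c, 1:] * q"
      by (metis dvdE poly_eq_0_iff_dvd)
    have "q \<noteq> 0"
      using Suc q by auto
    then have "degree p = Suc (degree q)"
      unfolding q by (subst degree_mult_eq) auto
    show ?case
    proof (cases "poly_apply scale T q x \<in> B")
      case True
      then show ?thesis
        using Suc \<open>q \<noteq> 0\<close> \<open>degree p = Suc (degree q)\<close> by simp
    next
      case False
      then show ?thesis
        using Suc.prems poly_apply_linear_factor[OF T, of c q x] poly_apply_mem[OF T W x(1), of q]
        by (auto simp: q)
    qed
  qed
qed

lemma eigenvector_mod_exists:
  fixes scale :: "'f::alg_closed_field \<Rightarrow> 'v::ab_group_add \<Rightarrow> 'v"
  assumes fd: "finite_dimensional_vector_space scale Basis"
    and T: "Vector_Spaces.linear scale scale T"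
    and B: "module.subspace scale B"
    and W: "module.subspace scale W" "T ` W \<subseteq> W" "\<not> W \<subseteq> B"
  shows "\<exists>c. \<exists>y\<in>W - B. T y - scale c y \<in> B"
proof -
  interpret finite_dimensional_vector_space scale Basis by fact
  obtain x where x: "x \<in> W" "x \<notin> B"
    using W by blast
  obtain p where "p \<noteq> 0" "poly_apply scale T p x = 0"
    using annihilating_poly_exists[OF T] by blast
  then show ?thesis
    using eigenvector_mod_of_annihilating_poly[OF vector_space_axioms T B W(1,2) x] B subspace_0
    by metis
qed

text \<open>
  On a minimal invariant subspace \<open>W\<close> strictly above \<open>B\<close>, every operator acts as a scalar
  modulo \<open>B\<close>, because its eigenspaces modulo \<open>B\<close> are invariant.
\<close>
lemma common_eigenvector_mod_exists:
  fixes scale :: "'f::alg_closed_field \<Rightarrow> 'v::ab_group_add \<Rightarrow> 'v"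
  assumes fd: "finite_dimensional_vector_space scale Basis"
    and T: "\<And>i. i \<in> I \<Longrightarrow> Vector_Spaces.linear scale scale (T i)"
    and B: "module.subspace scale B" "B \<noteq> UNIV"
    and TB: "\<And>i. i \<in> I \<Longrightarrow> T i ` B \<subseteq> B"
    and comm: "\<And>i j x. i \<in> I \<Longrightarrow> j \<in> I \<Longrightarrow> T i (T j x) = T j (T i x)"
  shows "\<exists>x. x \<notin> B \<and> (\<forall>i\<in>I. \<exists>c. T i x - scale c x \<in> B)"
proof -
  interpret finite_dimensional_vector_space scale Basis by fact
  define P where "P W \<longleftrightarrow> subspace W \<and> B \<subset> W \<and> (\<forall>i\<in>I. T i ` W \<subseteq> W)" for W
  have "P UNIV"
    using B by (auto simp: P_def)
  \<comment> \<open>Least dimension serves as the minimality of \<open>W\<close>.\<close>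
  then obtain W where W: "P W" and least: "\<And>V. P V \<Longrightarrow> dim W \<le> dim V"
    using exists_least_iff[of "\<lambda>n. \<exists>V. P V \<and> dim V = n"] by (metis linorder_not_le)
  have sW: "subspace W" "B \<subset> W" and TW: "\<And>i. i \<in> I \<Longrightarrow> T i ` W \<subseteq> W"
    using W by (auto simp: P_def)
  have "\<exists>c. \<forall>x\<in>W. T i x - scale c x \<in> B" if i: "i \<in> I" for i
  proof -
    obtain c y where y: "y \<in> W - B" "T i y - scale c y \<in> B"
      using eigenvector_mod_exists[OF fd T[OF i] B(1) sW(1) TW[OF i]] sW(2) by blast
    define E where "E = {x \<in> W. T i x - scale c x \<in> B}"
    have add: "T j (u + v) = T j u + T j v" and scl: "T j (scale a u) = scale a (T j u)"
      if "j \<in> I" for j u v a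
      using T[OF that] by (simp_all add: linear_iff_module_hom module_hom.add module_hom.scale)
    have "subspace E"
    proof (rule subspaceI)
      have "T i 0 = 0"
        using scl[OF i, of 0 0] by simp
      then show "0 \<in> E"
        using B sW by (simp add: E_def subspace_0)
    next
      fix u v assume "u \<in> E" "v \<in> E"
      moreover have "T i (u + v) - scale c (u + v) = (T i u - scale c u) + (T i v - scale c v)"
        by (simp add: add[OF i] scale_right_distrib)
      ultimately show "u + v \<in> E"
        unfolding E_def using sW B subspace_add by (metis (no_types, lifting) mem_Collect_eq)
    next
      fix a u assume "u \<in> E"
      moreover have "T i (scale a u) - scale c (scale a u) = scale a (T i u - scale c u)"
        by (simp add: scl[OF i] scale_right_diff_distrib mult.commute)
      ultimately show "scale a u \<in> E"
        unfolding E_def using sW B subspace_scale by (metis (no_types, lifting) mem_Collect_eq)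
    qed
    moreover have "T j ` E \<subseteq> E" if j: "j \<in> I" for j
    proof
      fix z assume "z \<in> T j ` E"
      then obtain u where u: "z = T j u" "u \<in> W" "T i u - scale c u \<in> B"
        by (auto simp: E_def)
      \<comment> \<open>\<open>T j\<close> commutes with \<open>T i\<close> minus the scalar
        \<open>c\<close> and preserves \<open>B\<close>, hence preserves the eigenspace
        \<open>E\<close>.\<close>
      have "T j (T i u) = T j (T i u - scale c u) + T j (scale c u)"
        using add[OF j, of "T i u - scale c u" "scale c u"] by simp
      then have "T i z - scale c z = T j (T i u - scale c u)"
        by (simp add: u(1) comm[OF i j] scl[OF j])
      then show "z \<in> E"
        using u TB[OF j] TW[OF j] by (auto simp: E_def)
    qed
    moreover have "B \<subset> E"
    proof -
      have "B \<subseteq> E"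
        using TB[OF i] B sW by (auto simp: E_def subspace_diff subspace_scale)
      then show ?thesis
        using y by (auto simp: E_def)
    qed
    ultimately have "P E"
      by (simp add: P_def)
    then have "E = W"
      using least \<open>subspace E\<close> sW by (intro subspace_dim_equal) (auto simp: E_def)
    then show ?thesis
      by (auto simp: E_def)
  qed
  then show ?thesis
    using sW by blast
qed

section \<open>Maximal abelian subalgebras\<close>

context poisson_algebra
begin

lemma mult_add_left: "(x + y) \<cdot> z = x \<cdot> z + y \<cdot> z"
  and mult_scale_left: "(a *s x) \<cdot> z = a *s (x \<cdot> z)"
  using module_hom.add[of scale scale "\<lambda>x. x \<cdot> z"] module_hom.scale[of scale scale "\<lambda>x. x \<cdot> z"]
    mult_linear_left by (simp_all add: linear_iff_module_hom)

lemma mult_add_right: "z \<cdot> (x + y) = z \<cdot> x + z \<cdot> y"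
  and mult_scale_right: "z \<cdot> (a *s x) = a *s (z \<cdot> x)"
  by (simp_all add: mult_commute[of z] mult_add_left mult_scale_left)

lemma brk_add_left: "brk (x + y) z = brk x z + brk y z"
  and brk_scale_left: "brk (a *s x) z = a *s brk x z"
  using module_hom.add[of scale scale "\<lambda>x. brk x z"] module_hom.scale[of scale scale "\<lambda>x. brk x z"]
    brk_linear_left by (simp_all add: linear_iff_module_hom)

lemma brk_add_right: "brk z (x + y) = brk z x + brk z y"
  and brk_scale_right: "brk z (a *s x) = a *s brk z x"
  using brk_linear_right[of z] by (simp_all add: linear_iff_module_hom module_hom.add module_hom.scale)

lemma mult_zero_left [simp]: "0 \<cdot> x = 0" and mult_zero_right [simp]: "x \<cdot> 0 = 0"
  and brk_zero_left [simp]: "brk 0 x = 0" and brk_zero_right [simp]: "brk x 0 = 0"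
  using mult_scale_left[of 0 0] mult_scale_right[of _ 0 0]
    brk_scale_left[of 0 0] brk_scale_right[of _ 0 0] by simp_all

lemma brk_antisym: "brk x y = - brk y x"
proof -
  have "brk (x + y) (x + y) = brk x y + brk y x"
    using brk_alternating[of x] brk_alternating[of y] by (simp add: brk_add_left brk_add_right)
  then show ?thesis
    by (simp add: brk_alternating eq_neg_iff_add_eq_0)
qed

lemma brk_leibniz_right: "brk z (x \<cdot> y) = brk z x \<cdot> y + x \<cdot> brk z y"
proof -
  have neg: "(- u) \<cdot> v = - (u \<cdot> v)" "u \<cdot> (- v) = - (u \<cdot> v)" for u v
    using mult_scale_left[of "- 1" u v] mult_scale_right[of u "- 1" v] by simp_all
  show ?thesis
    using brk_leibniz[of x y z] by (simp add: brk_antisym[of z] neg)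
qed

text \<open>The Jacobi identity in derivation form. When \<open>brk x y = 0\<close> it says that
  \<open>brk x\<close> and \<open>brk y\<close> commute as operators.\<close>

lemma brk_brk: "brk x (brk y z) = brk (brk x y) z + brk y (brk x z)"
proof -
  have neg: "brk u (- v) = - brk u v" for u v
    using brk_scale_right[of u "- 1" v] by simp
  have "brk y (brk z x) = - brk y (brk x z)" "brk z (brk x y) = - brk (brk x y) z"
    using brk_antisym[of z x] neg[of y] brk_antisym[of z "brk x y"] by simp_all
  then show ?thesis
    using brk_jacobi[of x y z] by (simp add: algebra_simps)
qed

lemmas mult_span_mem = span_bilinear_mem[OF mult_linear_left mult_linear_right]
lemmas brk_span_mem = span_bilinear_mem[OF brk_linear_left brk_linear_right]

lemma span_subalgebra:
  assumes "\<And>x y. x \<in> S \<Longrightarrow> y \<in> S \<Longrightarrow> x \<cdot> y \<in> span S"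
    and "\<And>x y. x \<in> S \<Longrightarrow> y \<in> S \<Longrightarrow> brk x y \<in> span S"
  shows "subalgebra (span S)"
  using mult_span_mem[OF subspace_span assms(1)] brk_span_mem[OF subspace_span assms(2)]
  by (simp add: subalgebra_def)

text \<open>Reduces \<open>square_space\<close> to single products. It is used with
  \<open>V = {0}\<close> to exploit abelianness and with \<open>V = B\<close> to bound the derived
  algebra.\<close>

lemma square_space_subset_iff:
  assumes "subspace V"
  shows "square_space A \<subseteq> V \<longleftrightarrow> (\<forall>x\<in>A. \<forall>y\<in>A. x \<cdot> y \<in> V \<and> brk x y \<in> V)"
proof
  assume sq: "square_space A \<subseteq> V"
  have "x \<cdot> y \<in> square_space A" "brk x y \<in> square_space A" if "x \<in> A" "y \<in> A" for x y
  proof -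
    have "x \<cdot> y \<in> mult_space A A" "brk x y \<in> brk_space A A"
      using that by (auto simp: mult_space_def brk_space_def intro!: span_base)
    moreover have "0 \<in> mult_space A A" "0 \<in> brk_space A A"
      by (simp_all add: mult_space_def brk_space_def span_zero)
    ultimately show "x \<cdot> y \<in> square_space A" "brk x y \<in> square_space A"
      unfolding square_space_def mem_Collect_eq by (metis add_0_right, metis add_0_left)
  qed
  then show "\<forall>x\<in>A. \<forall>y\<in>A. x \<cdot> y \<in> V \<and> brk x y \<in> V"
    using sq by blast
next
  assume prods: "\<forall>x\<in>A. \<forall>y\<in>A. x \<cdot> y \<in> V \<and> brk x y \<in> V"
  have "mult_space A A \<subseteq> V" "brk_space A A \<subseteq> V"
    unfolding mult_space_def brk_space_def using prods by (intro span_minimal assms; blast)+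
  then show "square_space A \<subseteq> V"
    using subspace_add[OF assms] unfolding square_space_def by blast
qed

lemma zero_mem_square_space: "0 \<in> square_space A"
  by (auto simp: square_space_def mult_space_def brk_space_def span_zero intro!: exI[of _ 0])

end

section \<open>Structure around a maximal abelian subalgebra\<close>

locale maximal_abelian_subalgebra = poisson_algebra +
  fixes B
  assumes maximal: "maximal_subalgebra B"
    and abelian: "abelian_subalgebra B"
begin

lemma subspace_B: "subspace B"
  using abelian by (simp add: abelian_subalgebra_def subalgebra_def)

lemma mult_B_B: "x \<in> B \<Longrightarrow> y \<in> B \<Longrightarrow> x \<cdot> y = 0"
  and brk_B_B: "x \<in> B \<Longrightarrow> y \<in> B \<Longrightarrow> brk x y = 0"
  using abelian square_space_subset_iff[of "{0}" B] by (auto simp: abelian_subalgebra_def)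

lemma subalgebra_above:
  assumes "subalgebra C" "B \<subseteq> C"
  shows "C = B \<or> C = UNIV"
  using maximal assms by (auto simp: maximal_subalgebra_def)

text \<open>
  The span of \<open>B \<union> B \<cdot> P\<close> is a subalgebra with zero multiplication. If it were all of \<open>P\<close>,
  then \<open>B \<cdot> P = 0\<close>.
\<close>
lemma mult_B_mem:
  assumes b: "b \<in> B"
  shows "b \<cdot> p \<in> B"
proof -
  define S where "S = B \<union> {b \<cdot> p | b p. b \<in> B}"
  have prod: "x \<cdot> y = 0" if "x \<in> S" "y \<in> S" for x y
  proof -
    \<comment> \<open>Here \<open>B \<cdot> (B \<cdot> P) = (B \<cdot> B) \<cdot> P = 0\<close>;
      products of two elements of \<open>B \<cdot> P\<close> reduce to this case.\<close>
    have B0: "c \<cdot> z = 0" if "c \<in> B" "z \<in> S" for c z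
      using that mult_B_B by (auto simp: S_def mult_assoc[symmetric])
    show ?thesis
    proof (cases "x \<in> B")
      case True
      then show ?thesis using B0 that by blast
    next
      case False
      then obtain c q where "x = c \<cdot> q" "c \<in> B"
        using \<open>x \<in> S\<close> by (auto simp: S_def)
      then show ?thesis
        using B0[of c y] that by (metis mult_assoc mult_commute mult_zero_right)
    qed
  qed
  have Sp: "x \<cdot> q \<in> span S" if "x \<in> S" for x q
  proof -
    have "x \<cdot> q \<in> S"
      using that by (fastforce simp: S_def mult_assoc)
    then show ?thesis
      by (rule span_base)
  qed
  have brB: "brk c x \<in> S" if c: "c \<in> B" and x: "x \<in> S" for c x
    using x
  proof (unfold S_def, elim UnE)
    assume "x \<in> B"
    then show "brk c x \<in> B \<union> {b \<cdot> p | b p. b \<in> B}"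
      using brk_B_B c subspace_0[OF subspace_B] by simp
  next
    assume "x \<in> {b \<cdot> p | b p. b \<in> B}"
    then show "brk c x \<in> B \<union> {b \<cdot> p | b p. b \<in> B}"
      using brk_B_B[OF c] by (fastforce simp: brk_leibniz_right)
  qed
  have br: "brk x y \<in> span S" if x: "x \<in> S" and y: "y \<in> S" for x y
  proof (cases "y \<in> B")
    case True
    then show ?thesis
      using span_neg[OF span_base[OF brB[OF True x]]] brk_antisym[of x y] by simp
  next
    case False
    then obtain c q where y: "y = c \<cdot> q" "c \<in> B"
      using y by (auto simp: S_def)
    \<comment> \<open>The sign moves to \<open>q\<close> so that \<open>Sp\<close> applies to
      \<open>brk c x\<close>, which \<open>brB\<close> places in \<open>S\<close>.\<close>
    have "brk x c \<cdot> q = (- brk c x) \<cdot> q"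
      using brk_antisym[of x c] by simp
    also have "\<dots> = brk c x \<cdot> (- q)"
      using mult_scale_left[of "- 1" "brk c x" q] mult_scale_right[of "brk c x" "- 1" q] by simp
    finally have "brk x c \<cdot> q \<in> span S"
      using Sp brB x y by simp
    moreover have "c \<cdot> brk x q \<in> span S"
      using y Sp by (simp add: S_def)
    ultimately show ?thesis
      by (simp add: y brk_leibniz_right span_add)
  qed
  have "subalgebra (span S)"
    using prod br by (intro span_subalgebra) (simp_all add: span_zero)
  moreover have "B \<subseteq> span S"
    using span_superset[of S] unfolding S_def by blast
  ultimately consider "span S = B" | "span S = UNIV"
    using subalgebra_above by blast
  then show ?thesis
  proof cases
    case 1
    then show ?thesis
      using Sp[of b p] b by (simp add: S_def)
  next
    case 2
    have "b \<cdot> p \<in> {0}"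
      by (rule mult_span_mem[OF subspace_single_0, of S]) (simp_all add: 2 prod)
    then show ?thesis
      using subspace_0[OF subspace_B] by simp
  qed
qed

lemma mult_mem_B: "b \<in> B \<Longrightarrow> p \<cdot> b \<in> B"
  using mult_B_mem mult_commute by simp

text \<open>Since \<open>B \<cdot> P\<close> lies in \<open>B\<close>, the hypotheses supply the
  remaining products needed to make the span a subalgebra. It contains \<open>B\<close> strictly, so
  maximality applies.\<close>

lemma span_insert_eq_UNIV:
  assumes "x \<notin> B" "x \<cdot> x \<in> span (insert x B)"
    and br: "\<And>b. b \<in> B \<Longrightarrow> brk b x \<in> span (insert x B)"
  shows "span (insert x B) = UNIV"
proof -
  have sub: "B \<subseteq> span (insert x B)" "x \<in> span (insert x B)"
    by (auto intro: span_base)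
  have "brk x b \<in> span (insert x B)" if "b \<in> B" for b
    using br[OF that] brk_antisym[of x b] span_neg by simp
  then have "subalgebra (span (insert x B))"
    using assms sub mult_B_mem mult_mem_B mult_B_B brk_B_B
    by (intro span_subalgebra) (auto simp: brk_alternating span_zero)
  then show ?thesis
    using subalgebra_above sub assms by blast
qed

text \<open>A derivation kills an idempotent; here the argument is run with an error term
  \<open>d\<close> in \<open>B\<close>. Once \<open>brk b u = 0\<close> for all \<open>b\<close> in
  \<open>B\<close>, the bracket vanishes on the generators \<open>insert u B\<close> of the whole
  algebra.\<close>

lemma brk_eq_0_if_idempotent_mod:
  assumes u: "u \<notin> B" "u \<cdot> u - u \<in> B"
  shows "brk y z = 0"
proof -
  define d where "d = u \<cdot> u - u"
  have uu: "u \<cdot> u = u + d" and d: "d \<in> B"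
    using u by (simp_all add: d_def)
  have bu: "brk b u = 0" if b: "b \<in> B" for b
  proof -
    define c where "c = brk b u"
    have c2: "c = u \<cdot> c + u \<cdot> c"
      using brk_leibniz_right[of b u u] brk_B_B[OF b d]
      by (simp add: uu brk_add_right c_def mult_commute)
    \<comment> \<open>Multiplying \<open>c2\<close> by \<open>u\<close> expresses
      \<open>u \<cdot> c\<close> through \<open>d \<cdot> c\<close>, which lies in \<open>B\<close>.
      Then \<open>c2\<close> puts \<open>c\<close> itself in \<open>B\<close>, so
      \<open>d \<cdot> c\<close> is zero. Sums instead of a factor 2 keep this valid in every
      characteristic.\<close>
    have "u \<cdot> (u \<cdot> c) = u \<cdot> c + d \<cdot> c"
      by (simp add: mult_assoc[symmetric] uu mult_add_left)
    then have "u \<cdot> c = (u \<cdot> c + d \<cdot> c) + (u \<cdot> c + d \<cdot> c)"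
      using arg_cong[OF c2, of "\<lambda>x. u \<cdot> x"] by (simp add: mult_add_right)
    then have uc: "u \<cdot> c = - (d \<cdot> c + d \<cdot> c)"
      by (simp add: algebra_simps eq_neg_iff_add_eq_0)
    then have "u \<cdot> c \<in> B"
      using mult_B_mem[OF d] subspace_add[OF subspace_B] subspace_neg[OF subspace_B] by metis
    then have "c \<in> B"
      using c2 subspace_add subspace_B by metis
    then have "u \<cdot> c = 0"
      using uc mult_B_B[OF d] by simp
    then show ?thesis
      using c2 c_def by simp
  qed
  have UNIV: "span (insert u B) = UNIV"
    using u bu d by (intro span_insert_eq_UNIV) (auto simp: uu span_zero intro: span_add span_base)
  have "brk u b = 0" if "b \<in> B" for b
    using bu[OF that] brk_antisym[of u b] by simp
  then have "brk s t \<in> {0}" if "s \<in> insert u B" "t \<in> insert u B" for s t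
    using that brk_B_B bu by (auto simp: brk_alternating)
  then have "brk y z \<in> {0}"
    using brk_span_mem[OF subspace_single_0] UNIV by blast
  then show ?thesis
    by simp
qed

text \<open>The subspace \<open>x \<cdot> P + B\<close> is a subalgebra above \<open>B\<close>. If
  it equals \<open>B\<close> the claim holds; if it is everything, an idempotent modulo
  \<open>B\<close> appears and forces the bracket to vanish.\<close>

lemma mult_eigenvector_mem:
  assumes x: "x \<notin> B" and ev: "\<And>b. b \<in> B \<Longrightarrow> \<exists>c. brk b x - c *s x \<in> B"
    and nontriv: "brk y z \<noteq> 0"
  shows "x \<cdot> p \<in> B"
proof -
  define S where "S = range (\<lambda>p. x \<cdot> p) \<union> B"
  have "subspace (range (\<lambda>p. x \<cdot> p))"
    using module_hom.subspace_image[of scale scale "\<lambda>p. x \<cdot> p" UNIV] mult_linear_right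
    by (simp add: linear_iff_module_hom)
  then have span_S: "span S = {x \<cdot> p + b | p b. b \<in> B}"
    using subspace_B by (auto simp: S_def span_Un span_eq_iff[THEN iffD2])
  have brB: "brk b s \<in> span S" if b: "b \<in> B" and s: "s \<in> S" for b s
  proof (cases "s \<in> B")
    case True
    then show ?thesis
      using b brk_B_B by (simp add: span_zero)
  next
    case False
    then obtain q where q: "s = x \<cdot> q"
      using s by (auto simp: S_def)
    obtain c where "brk b x - c *s x \<in> B"
      using ev b by blast
    then have "(brk b x - c *s x) \<cdot> q \<in> B"
      by (rule mult_B_mem)
    \<comment> \<open>In the Leibniz rule the scalar part of \<open>brk b x\<close> stays in
      \<open>x \<cdot> P\<close>, and the remainder times \<open>q\<close> is in
      \<open>B\<close>.\<close>
    moreover have "brk b s = x \<cdot> (c *s q + brk b q) + (brk b x - c *s x) \<cdot> q"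
      using mult_add_left[of "brk b x - c *s x" "c *s x" q]
      by (simp add: q brk_leibniz_right mult_add_right mult_scale_left mult_scale_right)
    ultimately show ?thesis
      unfolding span_S by blast
  qed
  have "subalgebra (span S)"
  proof (rule span_subalgebra)
    fix s t assume st: "s \<in> S" "t \<in> S"
    show "s \<cdot> t \<in> span S"
      using st mult_B_mem mult_mem_B by (auto simp: S_def mult_assoc intro!: span_base)
    show "brk s t \<in> span S"
    proof (cases "s \<in> B \<or> t \<in> B")
      case True
      then show ?thesis
        using brB st brk_antisym[of s t] span_neg by metis
    next
      case False
      then obtain p q where "s = x \<cdot> p" "t = x \<cdot> q"
        using st by (auto simp: S_def)
      \<comment> \<open>As \<open>brk x x = 0\<close>,
        \<open>brk (x \<cdot> p) x = x \<cdot> brk p x\<close>, so \<open>x\<close> factors out of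
        both Leibniz terms.\<close>
      then have "brk s t = x \<cdot> (brk p x \<cdot> q + brk (x \<cdot> p) q)"
        by (simp add: brk_leibniz_right[of _ x] brk_leibniz[of x p x] brk_alternating mult_add_right mult_assoc)
      then show ?thesis
        by (auto simp: S_def intro: span_base)
    qed
  qed
  moreover have "B \<subseteq> span S"
    by (auto simp: S_def intro: span_base)
  ultimately consider "span S = B" | "span S = UNIV"
    using subalgebra_above by blast
  then show ?thesis
  proof cases
    case 1
    then show ?thesis
      using span_base[of "x \<cdot> p" S] by (auto simp: S_def)
  next
    case 2
    \<comment> \<open>Decomposing \<open>x\<close> gives \<open>u\<close> acting as a unit on
      \<open>x\<close> modulo \<open>B\<close>. Decomposing \<open>u\<close> as
      \<open>x \<cdot> v + b'\<close> then gives \<open>u \<cdot> u \<equiv> (x \<cdot> u) \<cdot> v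
      \<equiv> x \<cdot> v \<equiv> u\<close> modulo \<open>B\<close>.\<close>
    obtain u b where u: "x = x \<cdot> u + b" "b \<in> B"
      using 2 span_S by blast
    obtain v b' where v: "u = x \<cdot> v + b'" "b' \<in> B"
      using 2 span_S by blast
    have "u \<notin> B"
      using u x mult_mem_B subspace_add subspace_B by metis
    have "u \<cdot> u = (x \<cdot> u) \<cdot> v + u \<cdot> b'"
      using v(1) by (metis mult_add_right mult_assoc mult_commute)
    moreover have "x \<cdot> v = (x \<cdot> u) \<cdot> v + b \<cdot> v"
      using u(1) by (metis mult_add_left)
    ultimately have "u \<cdot> u - (x \<cdot> v + b') = u \<cdot> b' - b \<cdot> v - b'"
      by (simp add: algebra_simps)
    then have "u \<cdot> u - u = u \<cdot> b' - b \<cdot> v - b'"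
      by (metis v(1))
    then have "u \<cdot> u - u \<in> B"
      using mult_B_mem[OF u(2)] mult_mem_B[OF v(2)] v(2) subspace_diff[OF subspace_B] by metis
    then show ?thesis
      using brk_eq_0_if_idempotent_mod \<open>u \<notin> B\<close> nontriv by blast
  qed
qed

text \<open>Since \<open>insert x B\<close> spans the algebra, products need checking only there.
  The delicate one is \<open>brk b x\<close>: a nonzero eigenvalue would annihilate the associative
  multiplication.\<close>

lemma derived_1_subset:
  assumes x: "x \<notin> B" and ev: "\<And>b. b \<in> B \<Longrightarrow> \<exists>c. brk b x - c *s x \<in> B"
    and nontriv: "\<not> trivial"
  shows "derived 1 \<subseteq> B"
proof -
  have xp: "x \<cdot> p \<in> B" for p
    using mult_eigenvector_mem[OF x ev] nontriv by (auto simp: trivial_def)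
  have "brk b x \<in> span (insert x B)" if b: "b \<in> B" for b
  proof -
    obtain c where "brk b x - c *s x \<in> B"
      using ev b by blast
    then have "(brk b x - c *s x) + c *s x \<in> span (insert x B)"
      by (intro span_add span_scale) (auto intro: span_base)
    then show ?thesis
      by simp
  qed
  then have UNIV: "span (insert x B) = UNIV"
    using x xp by (intro span_insert_eq_UNIV) (auto intro: span_base)
  have bx: "brk b x \<in> B" if b: "b \<in> B" for b
  proof (rule ccontr)
    assume nB: "brk b x \<notin> B"
    obtain c where c: "brk b x - c *s x \<in> B"
      using ev b by blast
    define d where "d = brk b x - c *s x"
    have d: "brk b x = c *s x + d" "d \<in> B"
      using c by (simp_all add: d_def)
    have "c \<noteq> 0"
      using d nB by auto
    have xB: "x \<cdot> a = 0" if a: "a \<in> B" for a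
    proof -
      \<comment> \<open>Leibniz gives
        \<open>brk b (x \<cdot> a) = c *s (x \<cdot> a) + d \<cdot> a\<close>, because
        \<open>brk b a = 0\<close>; the last term vanishes in \<open>B\<close>.\<close>
      have "c *s (x \<cdot> a) = brk b (x \<cdot> a)"
        using brk_B_B[OF b a] mult_B_B[OF d(2) a]
        by (simp add: brk_leibniz_right d(1) mult_add_left mult_scale_left)
      also have "\<dots> = 0"
        using brk_B_B b xp by blast
      finally show ?thesis
        using \<open>c \<noteq> 0\<close> by simp
    qed
    \<comment> \<open>The same device applied to \<open>b \<cdot> x\<close>, which is now known to
      be zero, kills \<open>x \<cdot> x\<close>.\<close>
    have "c *s (x \<cdot> x) = brk (b \<cdot> x) x"
      using xB[OF d(2)]
      by (simp add: brk_leibniz d(1) brk_alternating mult_add_left mult_scale_left mult_commute[of d])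
    also have "\<dots> = 0"
      using xB[OF b] by (simp add: mult_commute)
    finally have "x \<cdot> x = 0"
      using \<open>c \<noteq> 0\<close> by simp
    moreover have "a \<cdot> x = 0" if "a \<in> B" for a
      using xB[OF that] mult_commute[of a x] by simp
    ultimately have "s \<cdot> t \<in> {0}" if "s \<in> insert x B" "t \<in> insert x B" for s t
      using that xB mult_B_B by auto
    then have "y \<cdot> z \<in> {0}" for y z
      using mult_span_mem[OF subspace_single_0] UNIV by blast
    then show False
      using nontriv by (simp add: trivial_def)
  qed
  have xb: "brk x b \<in> B" if "b \<in> B" for b
    using bx[OF that] brk_antisym[of x b] subspace_neg[OF subspace_B] by simp
  have "s \<cdot> t \<in> B" "brk s t \<in> B" if "s \<in> insert x B" "t \<in> insert x B" for s t
    using that xp mult_B_mem brk_B_B bx xb subspace_0[OF subspace_B]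
    by (auto simp: brk_alternating)
  then have "y \<cdot> z \<in> B" "brk y z \<in> B" for y z
    using mult_span_mem[OF subspace_B, of "insert x B" y z]
      brk_span_mem[OF subspace_B, of "insert x B" y z] by (simp_all only: UNIV UNIV_I)
  then show ?thesis
    using square_space_subset_iff[OF subspace_B] by simp
qed

lemma derived_2_eq:
  assumes "derived 1 \<subseteq> B"
  shows "derived 2 = {0}"
proof -
  have "square_space (derived 1) \<subseteq> {0}"
    using assms mult_B_B brk_B_B by (subst square_space_subset_iff)
      (auto simp del: derived.simps simp: subspace_def subset_iff)
  then show ?thesis
    using zero_mem_square_space[of "derived 1"] by (auto simp: numeral_2_eq_2)
qed

end

theorem corollary3p1:
  fixes scale :: "'f::alg_closed_field \<Rightarrow> 'v::ab_group_add \<Rightarrow> 'v"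
    and mult brk :: "'v \<Rightarrow> 'v \<Rightarrow> 'v"
    and Basis B :: "'v set"
    and n :: nat
  assumes "poisson_algebra scale mult brk"
    and "\<not> poisson_algebra.trivial mult brk"
    and "finite_dimensional_vector_space scale Basis"
    and "vector_space.dim scale (UNIV :: 'v set) = n"
    and "poisson_algebra.maximal_subalgebra scale mult brk B"
    and "poisson_algebra.abelian_subalgebra scale mult brk B"
  shows "poisson_algebra.derived scale mult brk 1 \<subseteq> B \<and>
         poisson_algebra.solvable scale mult brk \<and>
         poisson_algebra.derived scale mult brk 2 = {0}"
proof -
  interpret maximal_abelian_subalgebra scale mult brk B
    using assms by (simp add: maximal_abelian_subalgebra_def maximal_abelian_subalgebra_axioms_def)
  have "brk b (brk c x) = brk c (brk b x)" if "b \<in> B" "c \<in> B" for b c x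
    using brk_brk[of b c x] brk_B_B[OF that] by simp
  \<comment> \<open>The commuting family is \<open>brk b\<close> for \<open>b\<close> in
    \<open>B\<close>; these operators send \<open>B\<close> to zero, hence preserve it.\<close>
  then obtain x where "x \<notin> B" "\<forall>b\<in>B. \<exists>c. brk b x - scale c x \<in> B"
    using common_eigenvector_mod_exists[OF assms(3), of B brk B] maximal brk_linear_right
      subspace_B subspace_0[OF subspace_B] brk_B_B
    by (auto simp: maximal_subalgebra_def)
  then have "derived 1 \<subseteq> B"
    using derived_1_subset assms(2) by blast
  then show ?thesis
    using derived_2_eq by (auto simp: solvable_def)
qed

end
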